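(* Let $A$ be a nonempty set, $\mathbb{F}$ a field, and $\mathscr{N}[A]$ the free non-associative $\mathbb{F}$-algebra on $A$. Let $\alpha_1 \subset \mathscr{N}[A]$ be an algebraically independent set of homogeneous $A$-polynomials which is of bounded degree. If $\alpha_2 \subset \mathscr{N}[A]$ is a linearly independent set of homogeneous $A$-polynomials all of the same degree $k \geq \deg(\alpha_1)$ and if $$\langle \alpha_1 \rangle \cap \operatorname{span}(\alpha_2) = \{0\},$$ then $\alpha = \alpha_1 \cup \alpha_2$ is an algebraically independent set.
   Context: An $\mathbb{F}$-algebra is an $\mathbb{F}$-vector space with a bilinear product (not assumed associative, commutative or unital). $\mathscr{M}[A]$ is the free magma on $A$; its elements are called $A$-monomials. The degree of an $A$-monomial is the positive integer determined by $\deg(a)=1$ for $a\in A$ and $\deg((m_1,m_2))=\deg(m_1)+\deg(m_2)$, where $(m_1,m_2)$ denotes the product. $\mathscr{N}[A]$ is the $\mathbb{F}$-vector space with basis $\mathscr{M}[A]$ with the bilinear product extending that of $\mathscr{M}[A]$; its elements are called $A$-polynomials. The degree $\deg(p)$ of a nonzero $A$-polynomial $p$ is the largest degree of an $A$-monomial occurring in $p$ with nonzero coefficient; the degree of $0$ is undefined. $\mathscr{H}_n[A]$ is the span of the $A$-monomials of degree $n$; nonzero elements of $\mathscr{H}_n[A]$ are called homogeneous $A$-polynomials of degree $n$. For indeterminates $X_1,\dots,X_n$, elements of $\mathscr{N}[X_1,\dots,X_n]$ (the free non-associative $\mathbb{F}$-algebra on $\{X_1,\dots,X_n\}$) are called polynomials.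 For elements $y_1,\dots,y_n$ of an $\mathbb{F}$-algebra $\mathscr{A}$, $P(y_1,\dots,y_n)$ is the image of $P$ under the unique algebra homomorphism $\mathscr{N}[X_1,\dots,X_n]\to\mathscr{A}$ with $X_i\mapsto y_i$. A subset $\alpha\subset\mathscr{A}$ is algebraically independent if for every $n \geq 1$, all distinct $y_1,\dots,y_n\in\alpha$ and every $P\in\mathscr{N}[X_1,\dots,X_n]$, $P(y_1,\dots,y_n)=0$ implies $P=0$. $\langle G\rangle$ denotes the subalgebra generated by $G$. A subset $T$ of $\mathscr{N}[A]$ is of bounded degree if there is a positive integer $N$ with $\deg(p)\le N$ for all nonzero $p\in T$. If $T$ is nonempty and of bounded degree, $\deg(T)$ denotes the smallest such $N$; $\deg(\emptyset)=0$. *)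

theory Defs
  imports Complex_Main "HOL-Library.Poly_Mapping"
begin

datatype 'a magma = Gen 'a | Mul "'a magma" "'a magma"

definition monomials :: "'a set \<Rightarrow> 'a magma set" where
  "monomials A = {m. set_magma m \<subseteq> A}"

primrec mdeg :: "'a magma \<Rightarrow> nat" where
  "mdeg (Gen a) = 1"
| "mdeg (Mul m1 m2) = mdeg m1 + mdeg m2"

primrec magma_lift :: "('b \<Rightarrow> 'b \<Rightarrow> 'b) \<Rightarrow> ('a \<Rightarrow> 'b) \<Rightarrow> 'a magma \<Rightarrow> 'b" where
  "magma_lift mult y (Gen a) = y a"
| "magma_lift mult y (Mul m1 m2) = mult (magma_lift mult y m1) (magma_lift mult y m2)"

type_synonym ('a, 'f) npoly = "'a magma \<Rightarrow>\<^sub>0 'f"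

definition npolys :: "'a set \<Rightarrow> ('a, 'f::zero) npoly set" where
  "npolys A = {p. Poly_Mapping.keys p \<subseteq> monomials A}"

lift_definition npscale :: "'f::field \<Rightarrow> ('a, 'f) npoly \<Rightarrow> ('a, 'f) npoly"
  is "\<lambda>c p m. c * p m"
  by (erule finite_subset[rotated]) auto

text \<open>Every monomial of degree at least two is a product in exactly one way, so the
  bilinear extension of the magma product has the coefficients below; see \<open>npmult_single\<close>.\<close>

lift_definition npmult :: "('a, 'f::field) npoly \<Rightarrow> ('a, 'f) npoly \<Rightarrow> ('a, 'f) npoly"
  is "\<lambda>p q m. case m of Gen a \<Rightarrow> 0 | Mul m1 m2 \<Rightarrow> p m1 * q m2"
proof -
  fix p q :: "'a magma \<Rightarrow> 'f"
  assume "finite {m. p m \<noteq> 0}" and "finite {m. q m \<noteq> 0}"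
  then have "finite (case_prod Mul ` ({m. p m \<noteq> 0} \<times> {m. q m \<noteq> 0}))"
    by blast
  then show "finite {m. (case m of Gen a \<Rightarrow> 0 | Mul m1 m2 \<Rightarrow> p m1 * q m2) \<noteq> 0}"
    by (rule finite_subset[rotated]) (force split: magma.splits)
qed

lemma npmult_single:
  "npmult (Poly_Mapping.single m1 c) (Poly_Mapping.single m2 d) = Poly_Mapping.single (Mul m1 m2) (c * d)"
  by (rule poly_mapping_eqI)
    (auto simp: npmult.rep_eq lookup_single when_def split: magma.splits)

lemma npmult_add_left: "npmult (p + p') q = npmult p q + npmult p' q"
  and npmult_add_right: "npmult p (q + q') = npmult p q + npmult p q'"
  by (rule poly_mapping_eqI; simp add: npmult.rep_eq lookup_add algebra_simps split: magma.split)+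

lemma npoly_eq_sum_single:
  fixes P :: "('a, 'f::field) npoly"
  shows "P = (\<Sum>m\<in>Poly_Mapping.keys P. Poly_Mapping.single m (Poly_Mapping.lookup P m))"
  by (rule poly_mapping_eqI) (simp add: lookup_sum lookup_single when_def in_keys_iff)

lemma npoly_induct [case_names zero single add]:
  fixes P :: "('a, 'f::field) npoly"
  assumes "Q 0" "\<And>m c. Q (Poly_Mapping.single m c)" "\<And>P P'. Q P \<Longrightarrow> Q P' \<Longrightarrow> Q (P + P')"
  shows "Q P"
proof -
  have "Q (\<Sum>m\<in>K. Poly_Mapping.single m (Poly_Mapping.lookup P m))" if "finite K" for K
    using that by (induction K) (auto intro: assms)
  from this[OF finite_keys[of P]] show ?thesis
    unfolding npoly_eq_sum_single[symmetric] .
qed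

locale nonassoc_algebra = vector_space scale
  for scale :: "'f::field \<Rightarrow> 'b::ab_group_add \<Rightarrow> 'b" +
  fixes mult :: "'b \<Rightarrow> 'b \<Rightarrow> 'b"
  assumes mult_add_left: "mult (x + x') z = mult x z + mult x' z"
    and mult_add_right: "mult x (z + z') = mult x z + mult x z'"
    and mult_scale_left: "mult (scale c x) z = scale c (mult x z)"
    and mult_scale_right: "mult x (scale c z) = scale c (mult x z)"
begin

definition subalgebra :: "'b set \<Rightarrow> bool" where
  "subalgebra B \<longleftrightarrow> subspace B \<and> (\<forall>x\<in>B. \<forall>z\<in>B. mult x z \<in> B)"

definition subalgebra_generated :: "'b set \<Rightarrow> 'b set" where
  "subalgebra_generated G = \<Inter>{B. subalgebra B \<and> G \<subseteq> B}"

text \<open>The homomorphism determined by \<open>Gen i \<mapsto> y i\<close>: see \<open>eval_single_Gen\<close>, \<open>eval_add\<close>,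
  \<open>eval_npscale\<close>, \<open>eval_npmult\<close> and \<open>eval_unique\<close>.\<close>

definition eval :: "('x \<Rightarrow> 'b) \<Rightarrow> ('x, 'f) npoly \<Rightarrow> 'b" where
  "eval y P = (\<Sum>m\<in>Poly_Mapping.keys P. scale (Poly_Mapping.lookup P m) (magma_lift mult y m))"

text \<open>The indeterminates \<open>X\<^sub>1, \<dots>, X\<^sub>n\<close> are the generators \<open>1, \<dots>, n\<close>.\<close>

definition algebraically_independent :: "'b set \<Rightarrow> bool" where
  "algebraically_independent S \<longleftrightarrow>
    (\<forall>n\<ge>1. \<forall>y :: nat \<Rightarrow> 'b. inj_on y {1..n} \<longrightarrow> y ` {1..n} \<subseteq> S \<longrightarrow>
      (\<forall>P\<in>npolys {1..n}. eval y P = 0 \<longrightarrow> P = 0))"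

lemma eval_superset:
  assumes "finite K" "Poly_Mapping.keys P \<subseteq> K"
  shows "eval y P = (\<Sum>m\<in>K. scale (Poly_Mapping.lookup P m) (magma_lift mult y m))"
  unfolding eval_def
  by (rule sum.mono_neutral_left) (use assms in \<open>auto simp: in_keys_iff\<close>)

lemma eval_zero: "eval y 0 = 0"
  by (simp add: eval_def)

lemma eval_single: "eval y (Poly_Mapping.single m c) = scale c (magma_lift mult y m)"
  by (subst eval_superset[of "{m}"]) auto

lemma eval_single_Gen: "eval y (Poly_Mapping.single (Gen i) 1) = y i"
  by (simp add: eval_single)

lemma eval_add: "eval y (P + Q) = eval y P + eval y Q"
proof -
  let ?K = "Poly_Mapping.keys P \<union> Poly_Mapping.keys Q"
  have "Poly_Mapping.keys (P + Q) \<subseteq> ?K"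
    by (rule Poly_Mapping.keys_add)
  then show ?thesis
    by (simp add: eval_superset[of ?K] lookup_add scale_left_distrib sum.distrib)
qed

lemma eval_npscale: "eval y (npscale c P) = scale c (eval y P)"
proof -
  have "Poly_Mapping.keys (npscale c P) \<subseteq> Poly_Mapping.keys P"
    by (auto simp: in_keys_iff npscale.rep_eq)
  then show ?thesis
    by (subst eval_superset[of "Poly_Mapping.keys P"])
      (auto simp: eval_def npscale.rep_eq scale_sum_right)
qed

lemma eval_npmult: "eval y (npmult P Q) = mult (eval y P) (eval y Q)"
proof (induction P rule: npoly_induct)
  case zero
  have "npmult 0 Q = 0" "mult 0 (eval y Q) = 0"
    using npmult_add_left[of 0 0 Q] mult_add_left[of 0 0 "eval y Q"] by auto
  then show ?case
    by (simp add: eval_zero)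
next
  case (single m c)
  show ?case
  proof (induction Q rule: npoly_induct)
    case zero
    let ?s = "Poly_Mapping.single m c"
    have "npmult ?s 0 = 0" "mult (eval y ?s) 0 = 0"
      using npmult_add_right[of ?s 0 0] mult_add_right[of "eval y ?s" 0 0] by auto
    then show ?case
      by (simp add: eval_zero)
  next
    case (single m' d)
    then show ?case
      by (simp add: npmult_single eval_single mult_scale_left mult_scale_right)
  qed (simp add: npmult_add_right mult_add_right eval_add)
qed (simp add: npmult_add_left mult_add_left eval_add)

lemma eval_unique:
  assumes gen: "\<And>i. i \<in> X \<Longrightarrow> h (Poly_Mapping.single (Gen i) 1) = y i"
    and add: "\<And>P Q. P \<in> npolys X \<Longrightarrow> Q \<in> npolys X \<Longrightarrow> h (P + Q) = h P + h Q"
    and scale: "\<And>c P. P \<in> npolys X \<Longrightarrow> h (npscale c P) = scale c (h P)"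
    and mult: "\<And>P Q. P \<in> npolys X \<Longrightarrow> Q \<in> npolys X \<Longrightarrow> h (npmult P Q) = mult (h P) (h Q)"
    and "P \<in> npolys X"
  shows "h P = eval y P"
proof -
  have mono: "h (Poly_Mapping.single m 1) = magma_lift mult y m" if "m \<in> monomials X" for m
    using that
  proof (induction m)
    case (Gen i)
    then show ?case by (simp add: gen monomials_def)
  next
    case (Mul m1 m2)
    then have "m1 \<in> monomials X" "m2 \<in> monomials X"
      by (auto simp: monomials_def)
    then show ?case
      using Mul.IH mult[of "Poly_Mapping.single m1 1" "Poly_Mapping.single m2 1"]
      by (simp add: npmult_single npolys_def)
  qed
  have single: "h (Poly_Mapping.single m c) = scale c (magma_lift mult y m)"
    if "m \<in> monomials X" for m c
  proof -
    have "npscale c (Poly_Mapping.single m 1) = Poly_Mapping.single m c"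
      by (rule poly_mapping_eqI) (simp add: npscale.rep_eq lookup_single when_def)
    then show ?thesis
      using scale[of "Poly_Mapping.single m 1" c] mono that by (simp add: npolys_def)
  qed
  have h0: "h 0 = 0"
    using add[of 0 0] by (simp add: npolys_def)
  have *: "(\<Sum>m\<in>K. Poly_Mapping.single m (Poly_Mapping.lookup P m)) \<in> npolys X \<and>
      h (\<Sum>m\<in>K. Poly_Mapping.single m (Poly_Mapping.lookup P m))
      = (\<Sum>m\<in>K. scale (Poly_Mapping.lookup P m) (magma_lift mult y m))"
    if "finite K" "K \<subseteq> monomials X" for K
    using that
  proof (induction K)
    case empty
    then show ?case by (simp add: h0 npolys_def)
  next
    case (insert m K)
    let ?S = "\<Sum>m\<in>K. Poly_Mapping.single m (Poly_Mapping.lookup P m)"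
    have "Poly_Mapping.single m (Poly_Mapping.lookup P m) \<in> npolys X"
      using insert.prems by (simp add: npolys_def)
    moreover from this have "Poly_Mapping.single m (Poly_Mapping.lookup P m) + ?S \<in> npolys X"
      using insert Poly_Mapping.keys_add[of "Poly_Mapping.single m (Poly_Mapping.lookup P m)" ?S]
      unfolding npolys_def by blast
    ultimately show ?case
      using insert by (simp add: add single)
  qed
  have "Poly_Mapping.keys P \<subseteq> monomials X"
    using \<open>P \<in> npolys X\<close> by (simp add: npolys_def)
  from *[OF finite_keys this, THEN conjunct2]
  have "h (\<Sum>m\<in>Poly_Mapping.keys P. Poly_Mapping.single m (Poly_Mapping.lookup P m)) = eval y P"
    unfolding eval_def .
  then show ?thesis
    unfolding npoly_eq_sum_single[symmetric] .
qed

end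

global_interpretation np: nonassoc_algebra npscale npmult
proof
qed (rule poly_mapping_eqI; simp add: npscale.rep_eq npmult.rep_eq lookup_add algebra_simps
    split: magma.split)+

lemma npolys_eq_span: "npolys A = np.span ((\<lambda>m. Poly_Mapping.single m 1) ` monomials A)"
proof (intro equalityI subsetI)
  fix P :: "('a, 'f::field) npoly"
  assume P: "P \<in> npolys A"
  have "P = (\<Sum>m\<in>Poly_Mapping.keys P. npscale (Poly_Mapping.lookup P m) (Poly_Mapping.single m 1))"
    by (rule poly_mapping_eqI)
      (simp add: lookup_sum npscale.rep_eq lookup_single when_def in_keys_iff if_distrib cong: if_cong)
  also have "\<dots> \<in> np.span ((\<lambda>m. Poly_Mapping.single m 1) ` monomials A)"
    using P by (intro np.span_sum np.span_scale np.span_base) (auto simp: npolys_def)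
  finally show "P \<in> np.span ((\<lambda>m. Poly_Mapping.single m 1) ` monomials A)" .
next
  fix P :: "('a, 'f::field) npoly"
  assume "P \<in> np.span ((\<lambda>m. Poly_Mapping.single m 1) ` monomials A)"
  moreover have "np.subspace (npolys A :: ('a, 'f) npoly set)"
  proof (rule np.subspaceI)
    fix x y :: "('a, 'f) npoly"
    assume "x \<in> npolys A" "y \<in> npolys A"
    then show "x + y \<in> npolys A"
      using Poly_Mapping.keys_add[of x y] by (auto simp: npolys_def)
  qed (auto simp: npolys_def subset_iff in_keys_iff npscale.rep_eq)
  moreover have "(\<lambda>m. Poly_Mapping.single m 1) ` monomials A \<subseteq> (npolys A :: ('a, 'f) npoly set)"
    by (auto simp: npolys_def)
  ultimately show "P \<in> npolys A"
    using np.span_minimal by blast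
qed

definition npdeg :: "('a, 'f::zero) npoly \<Rightarrow> nat" where
  "npdeg p = Max (mdeg ` Poly_Mapping.keys p)"

definition homogeneous_space :: "'a set \<Rightarrow> nat \<Rightarrow> ('a, 'f::field) npoly set" where
  "homogeneous_space A n =
    np.span ((\<lambda>m. Poly_Mapping.single m 1) ` {m \<in> monomials A. mdeg m = n})"

definition homogeneous :: "'a set \<Rightarrow> nat \<Rightarrow> ('a, 'f::field) npoly \<Rightarrow> bool" where
  "homogeneous A n p \<longleftrightarrow> p \<in> homogeneous_space A n \<and> p \<noteq> 0"

definition bounded_degree :: "('a, 'f::zero) npoly set \<Rightarrow> bool" where
  "bounded_degree T \<longleftrightarrow> (\<exists>N\<ge>1. \<forall>p\<in>T. p \<noteq> 0 \<longrightarrow> npdeg p \<le> N)"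

definition set_deg :: "('a, 'f::zero) npoly set \<Rightarrow> nat" where
  "set_deg T = (if T = {} then 0 else LEAST N. N \<ge> 1 \<and> (\<forall>p\<in>T. p \<noteq> 0 \<longrightarrow> npdeg p \<le> N))"

end

theory Submission
  imports Defs
begin

text \<open>
  The free non-associative algebra has no relations between products: if \<open>M\<close> is a linearly
  independent set, then so are the pairwise products of its elements, because a monomial of degree
  at least two factors in exactly one way. Hence a relation \<open>P(y\<^sub>1, \<dots>, y\<^sub>n) = 0\<close> without
  linear terms splits into relations of smaller degree, one for every left factor, and a
  nontrivial relation of least degree must have a linear term. So elements are algebraically
  independent as soon as no relation between them has a linear term
  (\<open>eval_injective_if_no_linear_terms\<close>).

  To exclude linear terms, give the indeterminate \<open>X\<^sub>i\<close> the degree of \<open>y\<^sub>i\<close> as its weight. As the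
  \<open>y\<^sub>i\<close> are homogeneous, the part of a relation of weight at most \<open>k\<close> is again a relation
  (\<open>eval_restrict_weight\<close>), and it contains all the linear terms since no element has degree
  above \<open>k\<close>. An indeterminate standing for an element of \<open>\<alpha>2\<close> already has weight \<open>k\<close>, so that in
  this part it can only occur as a linear term. The relation thus equates an element of the span
  of \<open>\<alpha>2\<close> with an element of the subalgebra generated by \<open>\<alpha>1\<close>. So both are zero; then the first
  one has zero coefficients by linear independence, and the second one comes from the zero
  polynomial by algebraic independence of \<open>\<alpha>1\<close>.
\<close>

section \<open>Evaluation of polynomials\<close>

lemma monomials_empty: "monomials {} = {}"
proof -
  have "set_magma m \<noteq> {}" for m :: "'a magma"
    by (induction m) auto
  then show ?thesis
    by (auto simp: monomials_def)
qed

lemma monomials_Mul: "Mul m1 m2 \<in> monomials X \<longleftrightarrow> m1 \<in> monomials X \<and> m2 \<in> monomials X"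
  by (auto simp: monomials_def)

lemma subalgebra_npolys: "np.subalgebra (npolys X :: ('x, 'f::field) npoly set)"
  unfolding np.subalgebra_def
proof (intro conjI ballI)
  show "np.subspace (npolys X :: ('x, 'f) npoly set)"
    unfolding npolys_eq_span by simp
next
  fix p q :: "('x, 'f) npoly"
  assume "p \<in> npolys X" "q \<in> npolys X"
  then show "npmult p q \<in> npolys X"
    by (auto simp: npolys_def subset_iff in_keys_iff npmult.rep_eq monomials_Mul
        split: magma.splits)
qed

lemma single_Gen_in_npolys: "i \<in> X \<Longrightarrow> Poly_Mapping.single (Gen i) c \<in> npolys X"
  by (simp add: npolys_def monomials_def)

lemma eval_generators: "P \<in> npolys X \<Longrightarrow> np.eval (\<lambda>i. Poly_Mapping.single (Gen i) 1) P = P"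
  by (rule np.eval_unique[symmetric, where h = "\<lambda>P. P" and X = X]) auto

context nonassoc_algebra
begin

lemma eval_in_subalgebra:
  assumes "subalgebra B" "\<And>i. i \<in> X \<Longrightarrow> y i \<in> B" "P \<in> npolys X"
  shows "eval y P \<in> B"
proof -
  have "magma_lift mult y m \<in> B" if "m \<in> monomials X" for m
    using that assms(1,2) by (induction m) (auto simp: monomials_def subalgebra_def)
  then show ?thesis
    using assms(1,3) unfolding eval_def subalgebra_def npolys_def
    by (blast intro: subspace_sum subspace_scale)
qed

lemma subalgebra_subalgebra_generated: "subalgebra (subalgebra_generated G)"
  unfolding subalgebra_def subalgebra_generated_def subspace_def by blast

lemma subalgebra_generated_superset: "G \<subseteq> subalgebra_generated G"
  unfolding subalgebra_generated_def by auto

lemma eval_cong: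
  assumes "\<And>i. i \<in> X \<Longrightarrow> y i = z i" "P \<in> npolys X"
  shows "eval y P = eval z P"
  by (rule eval_unique[where h = "eval y", OF _ _ _ _ assms(2)])
    (simp_all add: assms(1) eval_single_Gen eval_add eval_npscale eval_npmult)

lemma eval_eval:
  assumes "P \<in> npolys X"
  shows "eval z (np.eval y P) = eval (\<lambda>i. eval z (y i)) P"
  by (rule eval_unique[where h = "\<lambda>P. eval z (np.eval y P)", OF _ _ _ _ assms])
    (simp_all add: np.eval_single_Gen np.eval_add np.eval_npscale np.eval_npmult
      eval_add eval_npscale eval_npmult)

text \<open>Renaming the indeterminates along a bijection from \<open>I\<close> onto \<open>{1..n}\<close> is an invertible
  evaluation, so any finite index set serves as well as \<open>{1..n}\<close>.\<close>

lemma algebraically_independentD: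
  assumes S: "algebraically_independent S"
    and I: "finite I" "inj_on y I" "y ` I \<subseteq> S"
    and P: "P \<in> npolys I" "eval y P = 0"
  shows "P = 0"
proof (cases "I = {}")
  case True
  then show ?thesis
    using P(1) by (simp add: npolys_def monomials_empty)
next
  case False
  define n where "n = card I"
  obtain g where g: "bij_betw g I {1..n}"
    using finite_same_card_bij[OF I(1) finite_atLeastAtMost, of 1 n] by (auto simp: n_def)
  define h where "h = the_inv_into I g"
  have h: "bij_betw h {1..n} I"
    unfolding h_def by (rule bij_betw_the_inv_into[OF g])
  have hg: "h (g i) = i" if "i \<in> I" for i
    unfolding h_def using that by (rule the_inv_into_f_f[OF bij_betw_imp_inj_on[OF g]])
  define Q where "Q = np.eval (\<lambda>i. Poly_Mapping.single (Gen (g i)) 1) P"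
  have Qin: "Q \<in> npolys {1..n}"
    unfolding Q_def
    by (rule np.eval_in_subalgebra[OF subalgebra_npolys single_Gen_in_npolys P(1)])
      (rule bij_betwE[OF g, rule_format])
  have "eval (y \<circ> h) Q = eval y P"
    unfolding Q_def eval_eval[OF P(1)]
    by (rule eval_cong[OF _ P(1)]) (simp add: eval_single_Gen hg)
  moreover have "inj_on (y \<circ> h) {1..n}"
    using h I(2) by (metis bij_betw_def comp_inj_on)
  moreover have "(y \<circ> h) ` {1..n} \<subseteq> S"
    unfolding image_comp[symmetric] bij_betw_imp_surj_on[OF h] by (rule I(3))
  moreover have "n \<ge> 1"
    using False I(1) by (simp add: n_def Suc_le_eq card_gt_0_iff)
  ultimately have "Q = 0"
    using S[unfolded algebraically_independent_def, rule_format, of n "y \<circ> h" Q] Qin P(2)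
    by simp
  moreover have "np.eval (\<lambda>i. Poly_Mapping.single (Gen (h i)) 1) Q = P"
    unfolding Q_def np.eval_eval[OF P(1)] np.eval_single_Gen
    using np.eval_cong[OF _ P(1), of "\<lambda>i. Poly_Mapping.single (Gen (h (g i))) 1"
        "\<lambda>i. Poly_Mapping.single (Gen i) 1"] eval_generators[OF P(1)] hg
    by simp
  ultimately show "P = 0"
    by (simp add: np.eval_zero)
qed

end

section \<open>Relations of least degree have a linear term\<close>

lemma lookup_eval:
  assumes "finite K" "Poly_Mapping.keys P \<subseteq> K"
  shows "Poly_Mapping.lookup (np.eval y P) u =
    (\<Sum>m\<in>K. Poly_Mapping.lookup P m * Poly_Mapping.lookup (magma_lift npmult y m) u)"
  by (simp add: np.eval_superset[OF assms] lookup_sum npscale.rep_eq)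

lemma finite_factors:
  assumes "finite K"
  shows "finite {m. \<exists>m'. Mul m m' \<in> K \<or> Mul m' m \<in> K}"
proof (rule finite_subset)
  show "{m. \<exists>m'. Mul m m' \<in> K \<or> Mul m' m \<in> K} \<subseteq>
      (\<Union>m\<in>K. case m of Gen _ \<Rightarrow> {} | Mul m1 m2 \<Rightarrow> {m1, m2})"
    by force
  show "finite (\<Union>m\<in>K. case m of Gen _ \<Rightarrow> {} | Mul m1 m2 \<Rightarrow> {m1, m2})"
    using assms by (auto split: magma.split)
qed

lemma mdeg_pos: "0 < mdeg m"
  by (induction m) auto

text \<open>The two factors of a product have smaller degree, so that by induction the values of the
  factors occurring in the relation are linearly independent. Then so are the values of
  the products, whose coefficients are products of those of the factors.\<close>

lemma eval_injective_if_no_linear_terms: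
  fixes y :: "'x \<Rightarrow> ('a, 'f::field) npoly"
  assumes no_linear: "\<And>P i. P \<in> npolys X \<Longrightarrow> np.eval y P = 0 \<Longrightarrow> Poly_Mapping.lookup P (Gen i) = 0"
    and "P \<in> npolys X" "np.eval y P = 0"
  shows "P = 0"
proof -
  have "P = 0" if "\<forall>m\<in>Poly_Mapping.keys P. mdeg m < d" "P \<in> npolys X" "np.eval y P = 0" for d P
    using that
  proof (induction d arbitrary: P)
    case 0
    then show ?case by auto
  next
    case (Suc d)
    define M where
      "M = {m. \<exists>m'. Mul m m' \<in> Poly_Mapping.keys P \<or> Mul m' m \<in> Poly_Mapping.keys P}"
    have "finite M"
      unfolding M_def by (rule finite_factors) simp
    have M_deg: "mdeg m < d" if "m \<in> M" for m
    proof -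
      obtain m' where "Mul m m' \<in> Poly_Mapping.keys P \<or> Mul m' m \<in> Poly_Mapping.keys P"
        using \<open>m \<in> M\<close> unfolding M_def by blast
      then have "mdeg m + mdeg m' < Suc d"
        using Suc.prems(1) by force
      then show ?thesis
        using mdeg_pos[of m'] by simp
    qed
    have M_mono: "M \<subseteq> monomials X"
      using Suc.prems(2) unfolding M_def npolys_def by (auto simp: monomials_Mul subset_iff)
    let ?e = "\<lambda>m. Poly_Mapping.lookup (magma_lift npmult y m)"
    have indep: "c m = 0" if "\<And>u. (\<Sum>m\<in>M. c m * ?e m u) = 0" "m \<in> M" for c m
    proof -
      define R where "R = (\<Sum>m\<in>M. Poly_Mapping.single m (c m))"
      have R: "Poly_Mapping.lookup R m = (if m \<in> M then c m else 0)" for m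
        unfolding R_def using \<open>finite M\<close> by (simp add: lookup_sum lookup_single when_def)
      have keys_R: "Poly_Mapping.keys R \<subseteq> M"
        by (auto simp: in_keys_iff R split: if_splits)
      have "Poly_Mapping.lookup (np.eval y R) u = 0" for u
        unfolding lookup_eval[OF \<open>finite M\<close> keys_R] by (simp add: R that(1))
      then have "np.eval y R = 0"
        by (intro poly_mapping_eqI) simp
      moreover have "R \<in> npolys X"
        using keys_R M_mono by (auto simp: npolys_def)
      ultimately have "R = 0"
        using Suc.IH keys_R M_deg by blast
      then show ?thesis
        using R[of m] that(2) by simp
    qed
    have keys_P: "Poly_Mapping.keys P \<subseteq> (\<lambda>(m1, m2). Mul m1 m2) ` (M \<times> M)"
    proof
      fix m assume m: "m \<in> Poly_Mapping.keys P"
      then have "m \<noteq> Gen i" for i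
        using no_linear[OF Suc.prems(2,3)] by (auto simp: in_keys_iff)
      then obtain m1 m2 where "m = Mul m1 m2"
        by (cases m) auto
      moreover have "m1 \<in> M" "m2 \<in> M"
        using m calculation unfolding M_def by blast+
      ultimately show "m \<in> (\<lambda>(m1, m2). Mul m1 m2) ` (M \<times> M)"
        by auto
    qed
    \<comment> \<open>Comparing coefficients at \<open>Mul u v\<close> gives, for fixed \<open>v\<close>, a relation between the values of the
      left factors; each of its coefficients is, as \<open>v\<close> varies, a relation between the values of
      the right factors.\<close>
    let ?c = "\<lambda>m1 m2. Poly_Mapping.lookup P (Mul m1 m2)"
    have coeff: "(\<Sum>m1\<in>M. (\<Sum>m2\<in>M. ?c m1 m2 * ?e m2 v) * ?e m1 u) = 0" for u v
    proof -
      have "0 = Poly_Mapping.lookup (np.eval y P) (Mul u v)"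
        by (simp add: Suc.prems(3))
      also have "\<dots> = (\<Sum>(m1, m2)\<in>M \<times> M. ?c m1 m2 * (?e m1 u * ?e m2 v))"
        using \<open>finite M\<close>
        by (subst lookup_eval[OF _ keys_P])
          (auto simp: sum.reindex inj_on_def npmult.rep_eq intro!: sum.cong)
      also have "\<dots> = (\<Sum>m1\<in>M. (\<Sum>m2\<in>M. ?c m1 m2 * ?e m2 v) * ?e m1 u)"
        unfolding sum.cartesian_product[symmetric] sum_distrib_right
        by (intro sum.cong refl) (simp only: mult_ac)
      finally show ?thesis by simp
    qed
    have "?c m1 m2 = 0" if "m1 \<in> M" "m2 \<in> M" for m1 m2
      by (rule indep[OF indep[OF coeff \<open>m1 \<in> M\<close>] \<open>m2 \<in> M\<close>])
    then have "Poly_Mapping.keys P = {}"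
      using keys_P by (fastforce simp: in_keys_iff)
    then show "P = 0"
      by simp
  qed
  moreover have "\<forall>m\<in>Poly_Mapping.keys P. mdeg m < Suc (Max (mdeg ` Poly_Mapping.keys P))"
    by (simp add: less_Suc_eq_le)
  ultimately show ?thesis
    using assms(2,3) by blast
qed

section \<open>Homogeneity and weights\<close>

lemma homogeneous_mdeg:
  assumes "homogeneous A n p" "m \<in> Poly_Mapping.keys p"
  shows "mdeg m = n"
proof -
  let ?V = "{q :: ('a, 'b) npoly. \<forall>m. mdeg m \<noteq> n \<longrightarrow> Poly_Mapping.lookup q m = 0}"
  have "np.subspace ?V"
    by (rule np.subspaceI) (auto simp: lookup_add npscale.rep_eq)
  then have "homogeneous_space A n \<subseteq> ?V"
    unfolding homogeneous_space_def
    by (intro np.span_minimal) (auto simp: lookup_single when_def)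
  then show ?thesis
    using assms by (auto simp: homogeneous_def in_keys_iff)
qed

lemma npdeg_homogeneous:
  assumes "homogeneous A n p"
  shows "npdeg p = n"
proof -
  have "Poly_Mapping.keys p \<noteq> {}"
    using assms by (simp add: homogeneous_def)
  then have "mdeg ` Poly_Mapping.keys p = {n}"
    using homogeneous_mdeg[OF assms] by (auto simp del: keys_eq_empty)
  then show ?thesis
    by (simp add: npdeg_def)
qed

lemma homogeneous_degree_pos:
  assumes "homogeneous A n p"
  shows "0 < n"
proof -
  obtain m where "m \<in> Poly_Mapping.keys p"
    using assms unfolding homogeneous_def by (metis keys_eq_empty all_not_in_conv)
  then show ?thesis
    using homogeneous_mdeg[OF assms] mdeg_pos by blast
qed

lemma npdeg_le_set_deg:
  assumes "bounded_degree T" "p \<in> T" "p \<noteq> 0"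
  shows "npdeg p \<le> set_deg T"
proof -
  have "T \<noteq> {}"
    using assms(2) by auto
  moreover have "\<exists>N. N \<ge> 1 \<and> (\<forall>p\<in>T. p \<noteq> 0 \<longrightarrow> npdeg p \<le> N)"
    using assms(1) unfolding bounded_degree_def by blast
  from LeastI_ex[OF this] \<open>T \<noteq> {}\<close> show ?thesis
    using assms(2,3) by (simp add: set_deg_def)
qed

abbreviation weight :: "('x \<Rightarrow> nat) \<Rightarrow> 'x magma \<Rightarrow> nat" where
  "weight \<equiv> magma_lift (+)"

lemma weight_ge:
  assumes "i \<in> set_magma m"
  shows "w i \<le> weight w m"
  using assms by (induction m) auto

lemma weight_pos:
  assumes "\<And>i. i \<in> set_magma m \<Longrightarrow> 0 < w i"
  shows "0 < weight w m"
  using assms by (induction m) auto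

text \<open>The positive weight of the other factor pushes every product above the weight of the
  indeterminates occurring in it.\<close>

lemma weight_le_imp_Gen:
  assumes "\<And>i. i \<in> set_magma m \<Longrightarrow> 0 < w i" "i \<in> set_magma m" "weight w m \<le> w i"
  shows "m = Gen i"
proof (cases m)
  case (Gen j)
  then show ?thesis
    using assms(2) by simp
next
  case (Mul m1 m2)
  have "0 < weight w m1" "0 < weight w m2"
    using assms(1) Mul by (auto intro: weight_pos)
  moreover have "w i \<le> weight w m1 \<or> w i \<le> weight w m2"
    using assms(2) Mul by (auto intro: weight_ge)
  ultimately show ?thesis
    using assms(3) Mul by auto
qed

lemma mdeg_magma_lift:
  fixes y :: "'x \<Rightarrow> ('a, 'f::field) npoly"
  assumes "\<And>i u. i \<in> set_magma m \<Longrightarrow> u \<in> Poly_Mapping.keys (y i) \<Longrightarrow> mdeg u = w i"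
    and "u \<in> Poly_Mapping.keys (magma_lift npmult y m)"
  shows "mdeg u = weight w m"
  using assms
proof (induction m arbitrary: u)
  case (Mul m1 m2)
  from Mul.prems(2) obtain u1 u2 where u: "u = Mul u1 u2"
    and "u1 \<in> Poly_Mapping.keys (magma_lift npmult y m1)"
    and "u2 \<in> Poly_Mapping.keys (magma_lift npmult y m2)"
    by (cases u) (auto simp: in_keys_iff npmult.rep_eq)
  moreover have "\<And>i u. i \<in> set_magma m1 \<Longrightarrow> u \<in> Poly_Mapping.keys (y i) \<Longrightarrow> mdeg u = w i"
      "\<And>i u. i \<in> set_magma m2 \<Longrightarrow> u \<in> Poly_Mapping.keys (y i) \<Longrightarrow> mdeg u = w i"
    using Mul.prems(1) by auto
  ultimately show ?case
    using Mul.IH by simp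
qed simp

lift_definition restrict_monomials :: "'x magma set \<Rightarrow> ('x, 'f::zero) npoly \<Rightarrow> ('x, 'f) npoly"
  is "\<lambda>S p m. if m \<in> S then p m else 0"
  by (erule finite_subset[rotated]) auto

lemma keys_restrict_monomials:
  "Poly_Mapping.keys (restrict_monomials S P) = Poly_Mapping.keys P \<inter> S"
  by (auto simp: in_keys_iff restrict_monomials.rep_eq split: if_splits)

text \<open>A monomial of weight \<open>n\<close> takes a homogeneous value of degree \<open>n\<close>, so the part of \<open>P\<close> with
  weights in \<open>D\<close> takes as its value the part of the value of \<open>P\<close> with degrees in \<open>D\<close>.\<close>

lemma eval_restrict_weight:
  fixes y :: "'x \<Rightarrow> ('a, 'f::field) npoly"
  assumes hom: "\<And>i u. i \<in> X \<Longrightarrow> u \<in> Poly_Mapping.keys (y i) \<Longrightarrow> mdeg u = w i"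
    and P: "P \<in> npolys X"
  shows "np.eval y (restrict_monomials {m. weight w m \<in> D} P) =
    restrict_monomials {u. mdeg u \<in> D} (np.eval y P)"
proof (rule poly_mapping_eqI)
  fix u
  let ?e = "\<lambda>m. Poly_Mapping.lookup (magma_lift npmult y m) u"
  have deg: "mdeg u = weight w m" if "m \<in> Poly_Mapping.keys P" "?e m \<noteq> 0" for m
  proof (rule mdeg_magma_lift)
    show "mdeg v = w i" if "i \<in> set_magma m" "v \<in> Poly_Mapping.keys (y i)" for i v
      using that hom P \<open>m \<in> Poly_Mapping.keys P\<close> by (auto simp: npolys_def monomials_def)
    show "u \<in> Poly_Mapping.keys (magma_lift npmult y m)"
      using that by (simp add: in_keys_iff)
  qed
  have "Poly_Mapping.lookup (np.eval y (restrict_monomials {m. weight w m \<in> D} P)) u =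
      (\<Sum>m\<in>Poly_Mapping.keys P. (if weight w m \<in> D then Poly_Mapping.lookup P m else 0) * ?e m)"
    by (subst lookup_eval[of "Poly_Mapping.keys P"])
      (auto simp: keys_restrict_monomials restrict_monomials.rep_eq)
  also have "\<dots> = (\<Sum>m\<in>Poly_Mapping.keys P.
      if mdeg u \<in> D then Poly_Mapping.lookup P m * ?e m else 0)"
  proof (rule sum.cong[OF refl])
    fix m assume "m \<in> Poly_Mapping.keys P"
    then show "(if weight w m \<in> D then Poly_Mapping.lookup P m else 0) * ?e m =
        (if mdeg u \<in> D then Poly_Mapping.lookup P m * ?e m else 0)"
      using deg[of m] by (cases "?e m = 0") simp_all
  qed
  also have "\<dots> =
      Poly_Mapping.lookup (restrict_monomials {u. mdeg u \<in> D} (np.eval y P)) u"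
    by (simp add: restrict_monomials.rep_eq lookup_eval[of "Poly_Mapping.keys P"])
  finally show "Poly_Mapping.lookup (np.eval y (restrict_monomials {m. weight w m \<in> D} P)) u =
      Poly_Mapping.lookup (restrict_monomials {u. mdeg u \<in> D} (np.eval y P)) u" .
qed

section \<open>Adjoining elements of top degree\<close>

lemma (in vector_space) independent_family_coeff_zero:
  assumes "independent S" "finite J" "inj_on y J" "y ` J \<subseteq> S"
    and "(\<Sum>i\<in>J. scale (c i) (y i)) = 0" "i \<in> J"
  shows "c i = 0"
proof -
  have "(\<Sum>v\<in>y ` J. scale (c (the_inv_into J y v)) v) = 0"
    using assms(3,5) by (simp add: sum.reindex the_inv_into_f_f)
  with assms have "c (the_inv_into J y (y i)) = 0"
    by (intro independentD[OF assms(1), of "y ` J" "\<lambda>v. c (the_inv_into J y v)" "y i"]) auto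
  then show ?thesis
    using assms(3,6) by (simp add: the_inv_into_f_f)
qed

theorem theorem5:
  fixes A :: "'a set"
    and \<alpha>1 \<alpha>2 :: "('a, 'f::field) npoly set"
    and k :: nat
  assumes "A \<noteq> {}"
    and "\<alpha>1 \<subseteq> npolys A"
    and "np.algebraically_independent \<alpha>1"
    and "\<forall>p\<in>\<alpha>1. \<exists>n. homogeneous A n p"
    and "bounded_degree \<alpha>1"
    and "\<alpha>2 \<subseteq> npolys A"
    and "np.independent \<alpha>2"
    and "\<forall>p\<in>\<alpha>2. homogeneous A k p"
    and "k \<ge> set_deg \<alpha>1"
    and "np.subalgebra_generated \<alpha>1 \<inter> np.span \<alpha>2 = {0}"
  shows "np.algebraically_independent (\<alpha>1 \<union> \<alpha>2)"
  unfolding np.algebraically_independent_def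
proof (intro allI impI ballI)
  fix n and y :: "nat \<Rightarrow> ('a, 'f) npoly" and P :: "(nat, 'f) npoly"
  assume inj: "inj_on y {1..n}" and y: "y ` {1..n} \<subseteq> \<alpha>1 \<union> \<alpha>2"
  define I where "I = {i \<in> {1..n}. y i \<in> \<alpha>1}"
  define J where "J = {1..n} - I"
  define w where "w i = npdeg (y i)" for i
  have sub: "I \<subseteq> {1..n}" "J \<subseteq> {1..n}"
    unfolding I_def J_def by blast+
  have fin: "finite I" "finite J"
    by (rule finite_subset[OF sub(1)] finite_subset[OF sub(2)], simp)+
  have inj_IJ: "inj_on y I" "inj_on y J"
    using inj sub by (blast intro: inj_on_subset)+
  have image_I: "y ` I \<subseteq> \<alpha>1" and image_J: "y ` J \<subseteq> \<alpha>2"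
    using y unfolding I_def J_def by blast+
  have hom: "homogeneous A (w i) (y i)" if i: "i \<in> {1..n}" for i
  proof -
    have "\<exists>d. homogeneous A d (y i)"
      using y i assms(4,8) by blast
    then show ?thesis
      unfolding w_def using npdeg_homogeneous by blast
  qed
  have w_J: "w i = k" if "i \<in> J" for i
  proof -
    have "homogeneous A k (y i)"
      using that image_J assms(8) by blast
    then show ?thesis
      unfolding w_def by (rule npdeg_homogeneous)
  qed
  have w_I: "w i \<le> k" if "i \<in> I" for i
  proof -
    have "y i \<in> \<alpha>1" "y i \<noteq> 0"
      using that hom by (auto simp: I_def homogeneous_def)
    then show ?thesis
      using npdeg_le_set_deg[OF assms(5), of "y i"] assms(9) unfolding w_def by simp
  qed
  have no_linear: "Poly_Mapping.lookup P (Gen i) = 0"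
    if P: "P \<in> npolys {1..n}" "np.eval y P = 0" for P :: "(nat, 'f) npoly" and i
  proof -
    \<comment> \<open>The part of \<open>P\<close> of weight at most \<open>k\<close> is \<open>Z + Y\<close>, where \<open>Z\<close> is linear in the indeterminates
      of \<open>\<alpha>2\<close> and \<open>Y\<close> involves only those of \<open>\<alpha>1\<close>.\<close>
    define Z where "Z = restrict_monomials (Gen ` J) P"
    define Y where "Y = restrict_monomials (monomials I \<inter> {m. weight w m \<le> k}) P"
    have "restrict_monomials {m. weight w m \<in> {..k}} P = Z + Y"
    proof (rule poly_mapping_eqI)
      fix m
      show "Poly_Mapping.lookup (restrict_monomials {m. weight w m \<in> {..k}} P) m =
          Poly_Mapping.lookup (Z + Y) m"
      proof (cases "m \<in> Poly_Mapping.keys P")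
        case True
        then have m: "set_magma m \<subseteq> {1..n}"
          using P(1) by (auto simp: npolys_def monomials_def)
        have pos: "0 < w i" if "i \<in> set_magma m" for i
          using that m hom homogeneous_degree_pos by blast
        have "m \<in> Gen ` J \<and> m \<notin> monomials I" if "m \<notin> monomials I" "weight w m \<le> k"
        proof -
          obtain j where j: "j \<in> set_magma m" "j \<in> J"
            using \<open>m \<notin> monomials I\<close> m unfolding monomials_def J_def by blast
          then have "m = Gen j"
            using weight_le_imp_Gen[of m w j] pos \<open>weight w m \<le> k\<close> w_J by simp
          then show ?thesis
            using j that by blast
        qed
        moreover have "m \<notin> monomials I \<and> weight w m \<le> k" if "m \<in> Gen ` J"
          using that w_J by (auto simp: J_def monomials_def)
        ultimately show ?thesis
          by (auto simp: lookup_add Z_def Y_def restrict_monomials.rep_eq)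
      next
        case False
        then show ?thesis
          by (simp add: lookup_add Z_def Y_def restrict_monomials.rep_eq in_keys_iff)
      qed
    qed
    moreover have "np.eval y (restrict_monomials {m. weight w m \<in> {..k}} P) = 0"
      using homogeneous_mdeg[OF hom] P(2)
      by (subst eval_restrict_weight[OF _ P(1)])
        (auto intro!: poly_mapping_eqI simp: restrict_monomials.rep_eq)
    ultimately have sum: "np.eval y Z + np.eval y Y = 0"
      by (simp add: np.eval_add)
    have Z_sum: "np.eval y Z = (\<Sum>i\<in>J. npscale (Poly_Mapping.lookup P (Gen i)) (y i))"
      using fin(2)
      by (subst np.eval_superset[of "Gen ` J"])
        (auto simp: Z_def keys_restrict_monomials restrict_monomials.rep_eq sum.reindex inj_on_def)
    have "np.eval y Z \<in> np.span \<alpha>2"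
      unfolding Z_sum using image_J by (intro np.span_sum np.span_scale np.span_base) auto
    moreover have Y_in: "Y \<in> npolys I"
      by (auto simp: Y_def npolys_def keys_restrict_monomials)
    have "np.eval y Y \<in> np.subalgebra_generated \<alpha>1"
      using image_I np.subalgebra_generated_superset[of \<alpha>1]
      by (intro np.eval_in_subalgebra[OF np.subalgebra_subalgebra_generated _ Y_in]) auto
    then have "np.eval y Z \<in> np.subalgebra_generated \<alpha>1"
      using np.subalgebra_subalgebra_generated[of \<alpha>1] np.subspace_neg sum
      unfolding np.subalgebra_def by (metis eq_neg_iff_add_eq_0)
    ultimately have Z0: "np.eval y Z = 0"
      using assms(10) by blast
    then have "Y = 0"
      using sum
      by (intro np.algebraically_independentD[OF assms(3) fin(1) inj_IJ(1) image_I Y_in]) simp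
    consider "i \<in> I" | "i \<in> J" | "i \<notin> {1..n}"
      by (auto simp: J_def)
    then show "Poly_Mapping.lookup P (Gen i) = 0"
    proof cases
      case 1
      then have "Poly_Mapping.lookup P (Gen i) = Poly_Mapping.lookup Y (Gen i)"
        using w_I by (simp add: Y_def restrict_monomials.rep_eq monomials_def)
      then show ?thesis
        by (simp add: \<open>Y = 0\<close>)
    next
      case 2
      then show ?thesis
        using np.independent_family_coeff_zero
          [OF assms(7) fin(2) inj_IJ(2) image_J Z0[unfolded Z_sum]] by blast
    next
      case 3
      then show ?thesis
        using P(1) by (auto simp: npolys_def monomials_def in_keys_iff subset_iff)
    qed
  qed
  assume "P \<in> npolys {1..n}" "np.eval y P = 0"
  then show "P = 0"
    using eval_injective_if_no_linear_terms[of "{1..n}" y P] no_linear by blast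
qed

end
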